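(* Let $K_1\neq\{0\}$ be a cone in a (real) normed linear space $X_1$, and let $X_2$ be an infinite dimensional (real) normed linear space. Let $r_1,r_2>0$ and let $$T=(T_1,T_2):\overline{K}_{1,r_1}\times \overline{B}_{2,r_2}\longrightarrow K_1\times X_2$$ be a compact map such that $$\inf\{\|T_1(x,y)\| : x\in K_1,\ y\in X_2,\ \|x\|=r_1,\ \|y\|=r_2\}>0$$ and $$\inf\{\|T_2(x,y)\| : x\in K_1,\ y\in X_2,\ \|x\|=r_1,\ \|y\|=r_2\}>0.$$ Then there exist $\lambda_{1,1},\lambda_{2,1},\lambda_{1,2}>0$, $\lambda_{2,2}<0$ and $(x_{0,j},y_{0,j})\in \overline{K}_{1,r_1}\times \overline{B}_{2,r_2}$, $j=1,2$, with $\|x_{0,j}\|=r_1$ and $\|y_{0,j}\|=r_2$, such that $$x_{0,j}=\lambda_{1,j}\,T_1(x_{0,j},y_{0,j}),\qquad y_{0,j}=\lambda_{2,j}\,T_2(x_{0,j},y_{0,j})\qquad (j=1,2).$$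
   Context: A cone $K$ of a normed linear space $(X,\|\cdot\|)$ is a closed set $K\subset X$ with $K+K\subset K$, $\mu K\subset K$ for all $\mu\ge 0$, and $K\cap(-K)=\{0\}$. Notation: $\overline{K}_{1,r_1}=\{x\in K_1:\|x\|\le r_1\}$ and $\overline{B}_{2,r_2}=\{y\in X_2:\|y\|\le r_2\}$. The norms of all spaces are denoted by $\|\cdot\|$, and $X_1\times X_2$ carries the maximum norm. A compact map is a continuous map with relatively compact image. *)

theory Defs
  imports "HOL-Analysis.Analysis"
begin

text \<open>
  The library predicate \<^const>\<open>cone\<close> only expresses closure under nonnegative scaling.
  Nonemptiness is part of the condition \<^term>\<open>K \<inter> uminus ` K = {0}\<close>.
\<close>

definition closed_pointed_cone :: "'a::real_normed_vector set \<Rightarrow> bool" where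
  "closed_pointed_cone K \<longleftrightarrow>
     closed K \<and> (\<forall>x\<in>K. \<forall>y\<in>K. x + y \<in> K) \<and> cone K \<and> K \<inter> uminus ` K = {0}"

text \<open>
  A compact map from \<open>S\<close> to \<open>C\<close>: the image is relatively compact in \<open>C\<close>, i.e. its closure
  in the subspace \<open>C\<close> is compact. On a product type the notion refers to the product topology,
  which is the topology of the maximum norm (the library's product norm is the Euclidean one,
  equivalent to it).
\<close>

definition compact_map_on ::
    "'a::topological_space set \<Rightarrow> 'b::topological_space set \<Rightarrow> ('a \<Rightarrow> 'b) \<Rightarrow> bool" where
  "compact_map_on S C f \<longleftrightarrow>
     continuous_on S f \<and> f ` S \<subseteq> C \<and> compact (C \<inter> closure (f ` S))"

end

theory Submission
  imports Defs "HOL-Real_Asymp.Real_Asymp"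
begin

text \<open>
  It suffices to find a fixed point of the normalized map
  \<open>(x, y) \<mapsto> (r1 T1 / norm T1, r2 T2 / norm T2)\<close> on the product \<open>S\<close> of the two spheres; replacing
  \<open>T2\<close> by \<open>- T2\<close> then gives the solution with the negative multiplier. Approximate \<open>T\<close> up to
  \<open>\<epsilon>\<close> by \<open>\<Sum>i<n. \<phi>\<^sub>i(T z) w\<^sub>i\<close> with \<open>w\<^sub>i\<close> in the cone times \<open>X\<^sub>2\<close>. The sum ranges over the cone
  times a finite-dimensional space \<open>F\<close>, and this set can be mapped to \<open>S\<close> by normalizing, after
  small vectors have been pushed away from \<open>0\<close>: in the direction of a nonzero \<open>e\<close> in the cone, and of
  some \<open>v\<close> outside \<open>F\<close>, which exists as \<open>X\<^sub>2\<close> is infinite dimensional. Brouwer's theorem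
  for the coefficients gives a fixed point, at which no push took place because \<open>T\<close> is bounded away
  from \<open>0\<close> on \<open>S\<close>. Compactness allows \<open>\<epsilon> \<rightarrow> 0\<close>.

  The dimension varies within the proof, so the Brouwer theorem for Euclidean types does not apply;
  the Hilbert cube contains all the finite-dimensional cubes and has the fixed point property
  by Kuhn's combinatorial lemma.
\<close>

section \<open>The fixed point property of the Hilbert cube\<close>

lemma tendsto_fun_iff:
  fixes f :: "'c \<Rightarrow> 'i \<Rightarrow> 'd::topological_space"
  shows "(f \<longlongrightarrow> l) F \<longleftrightarrow> (\<forall>i. ((\<lambda>x. f x i) \<longlongrightarrow> l i) F)"
  using limitin_componentwise[of "\<lambda>_. euclidean" UNIV f l F]
  by (simp add: euclidean_product_topology)

lemma compact_unit_cube: "compact {x :: nat \<Rightarrow> real. \<forall>i. x i \<in> {0..1}}"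
proof -
  have "compactin (product_topology (\<lambda>i::nat. euclidean::real topology) UNIV) (PiE UNIV (\<lambda>_. {0..1}))"
    by (simp add: compactin_PiE)
  moreover have "PiE UNIV (\<lambda>_. {0..1}) = {x :: nat \<Rightarrow> real. \<forall>i. x i \<in> {0..1}}"
    by auto
  ultimately show ?thesis
    by (simp add: euclidean_product_topology)
qed

text \<open>Kuhn's lemma is applied to the grid of mesh \<open>1 / p\<close> in the first
  \<open>p\<close> coordinates, labelled by the sign of \<open>f x i - x i\<close>. Some cell has,
  for each \<open>i < p\<close>, two vertices with different labels; they become \<open>a\<close>
  and \<open>b\<close>, which may vary with \<open>i\<close>. Using \<open>p\<close> for both mesh
  and dimension lets one limit refine both.\<close>

lemma approximate_fixed_point_unit_cube:
  fixes f :: "(nat \<Rightarrow> real) \<Rightarrow> nat \<Rightarrow> real" and p :: nat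
  defines "Q \<equiv> {x. \<forall>i. x i \<in> {0..1}}"
  assumes fQ: "f \<in> Q \<rightarrow> Q" and p: "0 < p"
  obtains u where "u \<in> Q"
    "\<And>i. i < p \<Longrightarrow> \<exists>a\<in>Q. \<exists>b\<in>Q. (\<forall>j. \<bar>a j - u j\<bar> \<le> 1 / p) \<and> (\<forall>j. \<bar>b j - u j\<bar> \<le> 1 / p)
       \<and> a i \<le> f a i \<and> f b i \<le> b i"
proof -
  define g :: "(nat \<Rightarrow> nat) \<Rightarrow> nat \<Rightarrow> real" where "g x = (\<lambda>j. if j < p then x j / p else 0)" for x
  \<comment> \<open>Kuhn's lemma demands label 0 on the face \<open>x i = 0\<close> and label 1 on
    the face \<open>x i = p\<close>. These forced labels still give the right inequalities
    (\<open>lab0\<close>, \<open>lab1\<close>), since \<open>f\<close> maps into the cube.\<close>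
  define label :: "(nat \<Rightarrow> nat) \<Rightarrow> nat \<Rightarrow> nat" where
    "label x i = (if x i = 0 \<or> (x i < p \<and> g x i \<le> f (g x) i) then 0 else 1)" for x i
  have gQ: "g x \<in> Q" if "\<And>i. i < p \<Longrightarrow> x i \<le> p" for x
    using that p by (auto simp: g_def Q_def divide_simps)
  have lab0: "g x i \<le> f (g x) i" if "\<And>i. i < p \<Longrightarrow> x i \<le> p" "i < p" "label x i = 0" for x i
  proof (cases "x i = 0")
    case True
    have "f (g x) i \<ge> 0"
      using fQ gQ[OF that(1)] by (auto simp: Q_def)
    then show ?thesis
      using True by (simp add: g_def)
  qed (use that in \<open>auto simp: label_def split: if_splits\<close>)
  have lab1: "f (g x) i \<le> g x i" if "\<And>i. i < p \<Longrightarrow> x i \<le> p" "i < p" "label x i \<noteq> 0" for x i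
  proof (cases "x i = p")
    case True
    have "f (g x) i \<le> 1"
      using fQ gQ[OF that(1)] by (auto simp: Q_def)
    then show ?thesis
      using True that by (simp add: g_def)
  next
    case False
    then show ?thesis
      using that by (force simp: label_def split: if_splits)
  qed
  obtain q where q: "\<forall>i<p. q i < p" and
    rs: "\<forall>i<p. \<exists>r s. (\<forall>j<p. q j \<le> r j \<and> r j \<le> q j + 1) \<and> (\<forall>j<p. q j \<le> s j \<and> s j \<le> q j + 1)
           \<and> label r i \<noteq> label s i"
    by (rule kuhn_lemma[OF p, of p label]) (use p in \<open>auto simp: label_def\<close>)
  have near: "\<bar>g r j - g q j\<bar> \<le> 1 / p" if "\<forall>j<p. q j \<le> r j \<and> r j \<le> q j + 1" for r j
  proof (cases "j < p")
    case True
    then have "\<bar>real (r j) - real (q j)\<bar> \<le> 1"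
      using that by (smt (verit) of_nat_1 of_nat_add of_nat_mono)
    then show ?thesis
      using True p by (simp add: g_def divide_simps flip: diff_divide_distrib)
  qed (simp add: g_def)
  \<comment> \<open>As \<open>q j < p\<close>, all vertices of the cell stay in the grid.\<close>
  have bound: "r j \<le> p" if "\<forall>j<p. q j \<le> r j \<and> r j \<le> q j + 1" "j < p" for r j
  proof -
    have "r j \<le> q j + 1" "q j < p" using that q by auto
    then show ?thesis by linarith
  qed
  show ?thesis
  proof
    show "g q \<in> Q"
      using q by (intro gQ) (auto intro: less_imp_le)
    fix i assume i: "i < p"
    then obtain r s where r: "\<forall>j<p. q j \<le> r j \<and> r j \<le> q j + 1"
      and s: "\<forall>j<p. q j \<le> s j \<and> s j \<le> q j + 1" and ne: "label r i \<noteq> label s i"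
      using rs by blast
    have *: "g r \<in> Q" "g s \<in> Q"
      using r s bound by (auto intro!: gQ)
    show "\<exists>a\<in>Q. \<exists>b\<in>Q. (\<forall>j. \<bar>a j - g q j\<bar> \<le> 1 / p) \<and> (\<forall>j. \<bar>b j - g q j\<bar> \<le> 1 / p)
       \<and> a i \<le> f a i \<and> f b i \<le> b i"
    proof (cases "label r i = 0")
      case True
      then have "label s i \<noteq> 0" using ne by simp
      then have "g r i \<le> f (g r) i" "f (g s) i \<le> g s i"
        using lab0[OF bound[OF r] i True] lab1[OF bound[OF s] i] by simp_all
      then show ?thesis
        using * near[OF r] near[OF s]
        by (intro bexI[of _ "g r"] bexI[of _ "g s"] conjI allI)
    next
      case False
      then have "label s i = 0" using ne by (auto simp: label_def split: if_splits)
      then have "g s i \<le> f (g s) i" "f (g r) i \<le> g r i"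
        using lab0[OF bound[OF s] i] lab1[OF bound[OF r] i False] by simp_all
      then show ?thesis
        using * near[OF r] near[OF s]
        by (intro bexI[of _ "g s"] bexI[of _ "g r"] conjI allI)
    qed
  qed
qed

text \<open>By compactness the approximate fixed points cluster at some \<open>u\<close>. Each
  coordinate is tested from some index on, and the points where \<open>f x i - x i\<close> has
  either sign also tend to \<open>u\<close>, so continuity forces this difference to vanish
  there.\<close>

lemma fixed_point_unit_cube:
  fixes f :: "(nat \<Rightarrow> real) \<Rightarrow> nat \<Rightarrow> real"
  defines "Q \<equiv> {x. \<forall>i. x i \<in> {0..1}}"
  assumes cont: "continuous_on Q f" and fQ: "f \<in> Q \<rightarrow> Q"
  obtains u where "u \<in> Q" "f u = u"
proof -
  have "\<exists>u\<in>Q. \<forall>i<Suc n. \<exists>a\<in>Q. \<exists>b\<in>Q. (\<forall>j. \<bar>a j - u j\<bar> \<le> 1 / Suc n) \<and>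
      (\<forall>j. \<bar>b j - u j\<bar> \<le> 1 / Suc n) \<and> a i \<le> f a i \<and> f b i \<le> b i" for n
    using approximate_fixed_point_unit_cube[OF fQ[unfolded Q_def], of "Suc n"]
    unfolding Q_def[symmetric] by (metis zero_less_Suc)
  then obtain U where UQ: "\<And>n. U n \<in> Q" and
    U: "\<And>n. \<forall>i<Suc n. \<exists>a\<in>Q. \<exists>b\<in>Q. (\<forall>j. \<bar>a j - U n j\<bar> \<le> 1 / Suc n) \<and>
      (\<forall>j. \<bar>b j - U n j\<bar> \<le> 1 / Suc n) \<and> a i \<le> f a i \<and> f b i \<le> b i"
    by metis
  obtain u \<sigma> where u: "u \<in> Q" and \<sigma>: "strict_mono \<sigma>" and lim: "(U \<circ> \<sigma>) \<longlonglongrightarrow> u"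
    using compact_unit_cube UQ unfolding Q_def[symmetric] compact_def by metis
  \<comment> \<open>The threshold \<open>N\<close> is needed because coordinate \<open>i\<close> is
    controlled only once \<open>i < Suc (\<sigma> k)\<close>.\<close>
  have near: "A \<longlonglongrightarrow> u" if "\<And>k j. k \<ge> N \<Longrightarrow> \<bar>A k j - U (\<sigma> k) j\<bar> \<le> 1 / Suc (\<sigma> k)" for A N
    unfolding tendsto_fun_iff
  proof
    fix j
    have 1: "(\<lambda>k. U (\<sigma> k) j) \<longlonglongrightarrow> u j"
      using lim unfolding tendsto_fun_iff by simp
    have 2: "(\<lambda>k. 1 / real (Suc (\<sigma> k))) \<longlonglongrightarrow> 0"
      using LIMSEQ_subseq_LIMSEQ[OF LIMSEQ_inverse_real_of_nat \<sigma>]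
      by (simp add: o_def inverse_eq_divide)
    have "(\<lambda>k. A k j - U (\<sigma> k) j) \<longlonglongrightarrow> 0"
      by (rule Lim_null_comparison[OF _ 2])
        (use that in \<open>auto simp: eventually_sequentially simp del: of_nat_Suc\<close>)
    from tendsto_add[OF this 1] show "(\<lambda>k. A k j) \<longlonglongrightarrow> u j"
      by simp
  qed
  have lim_f: "(\<lambda>k. f (A k) i - A k i) \<longlonglongrightarrow> f u i - u i" if "A \<longlonglongrightarrow> u" "\<And>k. A k \<in> Q" for A i
    using continuous_on_tendsto_compose[OF cont that(1) u] that
    unfolding tendsto_fun_iff by (intro tendsto_diff) auto
  have "f u i = u i" for i
  proof -
    have "i < Suc (\<sigma> k)" if "i \<le> k" for k
      using that seq_suble[OF \<sigma>, of k] by simp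
    \<comment> \<open>For \<open>k < i\<close> only membership in \<open>Q\<close> is claimed, and
      \<open>u\<close> serves as a default.\<close>
    then have "\<forall>k. \<exists>a b. a \<in> Q \<and> b \<in> Q \<and> (i \<le> k \<longrightarrow> (\<forall>j. \<bar>a j - U (\<sigma> k) j\<bar> \<le> 1 / Suc (\<sigma> k)) \<and>
      (\<forall>j. \<bar>b j - U (\<sigma> k) j\<bar> \<le> 1 / Suc (\<sigma> k)) \<and> a i \<le> f a i \<and> f b i \<le> b i)"
      using U u by metis
    then obtain A B where AB: "\<And>k. A k \<in> Q" "\<And>k. B k \<in> Q"
      "\<And>k j. i \<le> k \<Longrightarrow> \<bar>A k j - U (\<sigma> k) j\<bar> \<le> 1 / Suc (\<sigma> k)"
      "\<And>k j. i \<le> k \<Longrightarrow> \<bar>B k j - U (\<sigma> k) j\<bar> \<le> 1 / Suc (\<sigma> k)"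
      "\<And>k. i \<le> k \<Longrightarrow> A k i \<le> f (A k) i" "\<And>k. i \<le> k \<Longrightarrow> f (B k) i \<le> B k i"
      by metis
    have "0 \<le> f u i - u i"
      by (rule tendsto_lowerbound[OF lim_f[OF near[OF AB(3)] AB(1)]])
        (use AB(5) in \<open>auto simp: eventually_sequentially\<close>)
    moreover have "f u i - u i \<le> 0"
      by (rule tendsto_upperbound[OF lim_f[OF near[OF AB(4)] AB(2)]])
        (use AB(6) in \<open>auto simp: eventually_sequentially\<close>)
    ultimately show ?thesis by simp
  qed
  then show ?thesis
    using that u by blast
qed

section \<open>Finite-dimensional approximation on a compact set\<close>

text \<open>This is the Schauder projection: a partition of unity subordinate to the balls around a
  finite \<open>\<epsilon>\<close>-net replaces \<open>z\<close> by an average of net points within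
  \<open>\<epsilon>\<close> of it.\<close>

lemma compact_finite_dim_approximation:
  fixes C :: "'c::real_normed_vector set"
  assumes "compact C" "0 < \<epsilon>"
  obtains n w and \<phi> :: "nat \<Rightarrow> 'c \<Rightarrow> real" where
    "\<And>i. i < n \<Longrightarrow> w i \<in> C" "\<And>i. continuous_on C (\<phi> i)"
    "\<And>i z. z \<in> C \<Longrightarrow> \<phi> i z \<in> {0..1}"
    "\<And>z. z \<in> C \<Longrightarrow> norm ((\<Sum>i<n. \<phi> i z *\<^sub>R w i) - z) \<le> \<epsilon>"
proof -
  obtain k where k: "finite k" "k \<subseteq> C" "C \<subseteq> (\<Union>x\<in>k. ball x \<epsilon>)"
    using seq_compact_imp_totally_bounded compact_imp_seq_compact assms by metis
  obtain n and w :: "nat \<Rightarrow> 'c" where w: "k = w ` {..<n}"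
    using finite_imp_nat_seg_image_inj_on[OF k(1)] by (auto simp: lessThan_def)
  define h where "h i z = max 0 (\<epsilon> - dist (w i) z)" for i z
  define s where "s z = (\<Sum>i<n. h i z)" for z
  \<comment> \<open>The value 0 for \<open>i \<ge> n\<close> makes the whole sequence of weights a
    point of the Hilbert cube.\<close>
  define \<phi> where "\<phi> i z = (if i < n then h i z / s z else 0)" for i z
  have h0: "0 \<le> h i z" for i z by (simp add: h_def)
  have s0: "0 < s z" if z: "z \<in> C" for z
  proof -
    obtain i where i: "i < n" "z \<in> ball (w i) \<epsilon>" using z k(3) w by blast
    then have "0 < h i z" by (simp add: h_def)
    then show ?thesis
      unfolding s_def using i h0 by (intro sum_pos2[of _ i]) auto
  qed
  have "continuous_on C (\<phi> i)" for i
  proof (cases "i < n")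
    case True
    then show ?thesis
      unfolding \<phi>_def using s0
      by (auto simp: h_def s_def intro!: continuous_intros) (metis h_def s_def less_irrefl)
  qed (simp add: \<phi>_def)
  moreover have "\<phi> i z \<in> {0..1}" if "z \<in> C" for i z
  proof -
    have "h i z \<le> s z" if "i < n"
      unfolding s_def using that h0 by (intro member_le_sum) auto
    then show ?thesis
      using h0[of i z] s0[OF that] by (simp add: \<phi>_def)
  qed
  moreover have "norm ((\<Sum>i<n. \<phi> i z *\<^sub>R w i) - z) \<le> \<epsilon>" if z: "z \<in> C" for z
  proof -
    have sum1: "(\<Sum>i<n. \<phi> i z) = 1"
      using s0[OF z] by (simp add: \<phi>_def s_def flip: sum_divide_distrib)
    have "(\<Sum>i<n. \<phi> i z *\<^sub>R w i) - z = (\<Sum>i<n. \<phi> i z *\<^sub>R (w i - z))"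
      by (simp add: scaleR_diff_right sum_subtractf sum1 flip: scaleR_sum_left)
    also have "norm \<dots> \<le> (\<Sum>i<n. \<phi> i z * \<epsilon>)"
    proof (rule sum_norm_le)
      fix i assume "i \<in> {..<n}"
      have "\<phi> i z = 0 \<or> norm (w i - z) \<le> \<epsilon>"
        by (auto simp: \<phi>_def h_def dist_norm)
      moreover have "0 \<le> \<phi> i z"
        using h0[of i z] s0[OF z] by (simp add: \<phi>_def)
      ultimately show "norm (\<phi> i z *\<^sub>R (w i - z)) \<le> \<phi> i z * \<epsilon>"
        by (auto intro: mult_left_mono)
    qed
    also have "\<dots> = \<epsilon>" by (simp add: sum1 flip: sum_distrib_right)
    finally show ?thesis .
  qed
  ultimately show ?thesis
    using that[of n w \<phi>] w k(2) by blast
qed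

section \<open>Continuous normalization onto spheres\<close>

text \<open>The summand \<open>max 0 (\<delta> - norm x) *\<^sub>R e\<close> is the push; it makes the map continuous at \<open>0\<close>.\<close>

definition radial :: "real \<Rightarrow> real \<Rightarrow> 'c \<Rightarrow> 'c \<Rightarrow> 'c::real_normed_vector" where
  "radial r \<delta> e x = (let z = x + max 0 (\<delta> - norm x) *\<^sub>R e in (r / norm z) *\<^sub>R z)"

lemma radial_eq: "\<delta> \<le> norm x \<Longrightarrow> radial r \<delta> e x = (r / norm x) *\<^sub>R x"
  by (simp add: radial_def)

text \<open>If \<open>norm x < \<delta>\<close>, the coefficient of \<open>e\<close> is positive and
  the hypothesis applies; otherwise there is no push and \<open>x\<close> itself is nonzero.\<close>

lemma radial_shift_nonzero:
  fixes x e :: "'c::real_normed_vector"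
  assumes "0 < \<delta>" "\<And>t. 0 < t \<Longrightarrow> x + t *\<^sub>R e \<noteq> 0"
  shows "x + max 0 (\<delta> - norm x) *\<^sub>R e \<noteq> 0"
  using assms by (cases "norm x < \<delta>") (auto simp: max_def)

lemma norm_radial:
  assumes "0 < r" "0 < \<delta>" "\<And>t. 0 < t \<Longrightarrow> x + t *\<^sub>R e \<noteq> 0"
  shows "norm (radial r \<delta> e x) = r"
  using radial_shift_nonzero[OF assms(2,3)] assms(1) by (simp add: radial_def Let_def)

lemma continuous_on_radial:
  assumes "0 < \<delta>" "\<And>x t. x \<in> D \<Longrightarrow> 0 < t \<Longrightarrow> x + t *\<^sub>R e \<noteq> 0"
  shows "continuous_on D (radial r \<delta> e)"
proof -
  have "\<forall>x\<in>D. norm (x + max 0 (\<delta> - norm x) *\<^sub>R e) \<noteq> 0"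
    unfolding norm_eq_zero
  proof
    fix x assume "x \<in> D"
    then show "x + max 0 (\<delta> - norm x) *\<^sub>R e \<noteq> 0"
      by (intro radial_shift_nonzero assms)
  qed
  then show ?thesis
    unfolding radial_def Let_def by (intro continuous_intros)
qed

section \<open>Finite spans and sums in a cone\<close>

lemma infinite_dim_span_finite:
  fixes A :: "'b::real_normed_vector set"
  assumes "\<nexists>B. finite_dimensional_vector_space ((*\<^sub>R) :: real \<Rightarrow> 'b \<Rightarrow> 'b) B" "finite A"
  shows "span A \<noteq> UNIV"
proof
  assume span: "span A = UNIV"
  obtain B where B: "B \<subseteq> A" "independent B" "A \<subseteq> span B"
    using maximal_independent_subset by blast
  then have "span B = UNIV"
    using span by (metis span_span span_mono top.extremum_uniqueI)
  then have "finite_dimensional_vector_space ((*\<^sub>R) :: real \<Rightarrow> 'b \<Rightarrow> 'b) B"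
    using B finite_subset[OF _ assms(2)]
    by unfold_locales (auto simp: dependent_raw_def span_raw_def)
  then show False using assms(1) by blast
qed

lemma closed_pointed_cone_sum:
  assumes "closed_pointed_cone K" "\<And>i. i \<in> I \<Longrightarrow> 0 \<le> c i" "\<And>i. i \<in> I \<Longrightarrow> w i \<in> K"
  shows "(\<Sum>i\<in>I. c i *\<^sub>R w i) \<in> K"
proof (cases "finite I")
  case True
  then show ?thesis
    using assms(2,3)
    by (induction I) (use assms(1) in \<open>auto simp: closed_pointed_cone_def cone_def\<close>)
qed (use assms(1) in \<open>auto simp: closed_pointed_cone_def\<close>)

section \<open>Fixed points of the normalized map\<close>

lemma approximate_normalized_fixed_point:
  fixes K :: "'a::real_normed_vector set"
    and T :: "'a \<times> 'b::real_normed_vector \<Rightarrow> 'a \<times> 'b"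
    and r1 r2 d \<epsilon> :: real
  defines "S \<equiv> {(x, y). x \<in> K \<and> norm x = r1 \<and> norm y = r2}"
  assumes K: "closed_pointed_cone K" "K \<noteq> {0}"
    and inf_dim: "\<nexists>B. finite_dimensional_vector_space ((*\<^sub>R) :: real \<Rightarrow> 'b \<Rightarrow> 'b) B"
    and r: "0 < r1" "0 < r2"
    and C: "compact C" "C \<subseteq> K \<times> UNIV"
    and T: "continuous_on S T" "T \<in> S \<rightarrow> C"
    and d: "\<And>z. z \<in> S \<Longrightarrow> d \<le> norm (fst (T z))" "\<And>z. z \<in> S \<Longrightarrow> d \<le> norm (snd (T z))"
    and \<epsilon>: "0 < \<epsilon>" "\<epsilon> < d"
  obtains z g where "z \<in> S" "norm (g - T z) \<le> \<epsilon>"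
    "z = ((r1 / norm (fst g)) *\<^sub>R fst g, (r2 / norm (snd g)) *\<^sub>R snd g)"
proof -
  obtain n w and \<phi> :: "nat \<Rightarrow> 'a \<times> 'b \<Rightarrow> real" where
    w: "\<And>i. i < n \<Longrightarrow> w i \<in> C" and \<phi>_cont: "\<And>i. continuous_on C (\<phi> i)"
    and \<phi>: "\<And>i z. z \<in> C \<Longrightarrow> \<phi> i z \<in> {0..1}"
    and approx: "\<And>z. z \<in> C \<Longrightarrow> norm ((\<Sum>i<n. \<phi> i z *\<^sub>R w i) - z) \<le> \<epsilon>"
    by (rule compact_finite_dim_approximation[OF C(1) \<epsilon>(1)]) (rule that)
  define F where "F = span ((\<lambda>i. snd (w i)) ` {..<n})"
  have "0 \<in> K"
    using K(1) by (auto simp: closed_pointed_cone_def)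
  then obtain e where e: "e \<in> K" "e \<noteq> 0"
    using K(2) by blast
  have "F \<noteq> UNIV"
    unfolding F_def by (intro infinite_dim_span_finite[OF inf_dim]) auto
  then obtain v where v: "v \<notin> F"
    by blast
  \<comment> \<open>At the fixed point \<open>g\<close> is within \<open>\<epsilon>\<close> of
    \<open>T z\<close>, whose components have norm at least \<open>d\<close>. Those of
    \<open>g\<close> thus have norm at least \<open>d - \<epsilon>\<close>, where
    \<open>radial\<close> is plain normalization.\<close>
  define \<delta> where "\<delta> = d - \<epsilon>"
  have \<delta>: "0 < \<delta>" using \<epsilon> by (simp add: \<delta>_def)
  \<comment> \<open>Pointedness of the cone: otherwise \<open>t *\<^sub>R e\<close>, which is
    nonzero, would lie in both \<open>K\<close> and its negative.\<close>
  have K_shift: "x + t *\<^sub>R e \<noteq> 0" if "x \<in> K" "0 < t" for x t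
  proof
    assume "x + t *\<^sub>R e = 0"
    then have "t *\<^sub>R e = - x"
      by (simp add: add_eq_0_iff)
    moreover have "t *\<^sub>R e \<in> K"
      using K(1) e(1) that(2) by (simp add: closed_pointed_cone_def cone_def)
    ultimately have "t *\<^sub>R e \<in> K \<inter> uminus ` K"
      using that(1) by auto
    moreover have "K \<inter> uminus ` K = {0}"
      using K(1) by (simp add: closed_pointed_cone_def)
    ultimately have "t *\<^sub>R e = 0"
      by blast
    then show False
      using e(2) that(2) by simp
  qed
  have F_shift: "y + t *\<^sub>R v \<noteq> 0" if "y \<in> F" "0 < t" for y t
  proof
    assume "y + t *\<^sub>R v = 0"
    then have "t *\<^sub>R v = - y"
      by (simp add: add_eq_0_iff)
    then have "t *\<^sub>R v \<in> F"
      using that(1) span_neg unfolding F_def by simp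
    then have "(1 / t) *\<^sub>R t *\<^sub>R v \<in> F"
      unfolding F_def by (rule span_scale)
    then show False
      using v that(2) by simp
  qed
  define R where "R z = (radial r1 \<delta> e (fst z), radial r2 \<delta> v (snd z))" for z
  have R_in: "R z \<in> S" if "z \<in> K \<times> F" for z
  proof -
    have "fst z + max 0 (\<delta> - norm (fst z)) *\<^sub>R e \<in> K"
      using K(1) e(1) that by (auto simp: closed_pointed_cone_def cone_def)
    then have "radial r1 \<delta> e (fst z) \<in> K"
      using K(1) r(1) by (simp add: radial_def Let_def closed_pointed_cone_def cone_def)
    then show ?thesis
      using that norm_radial[OF r(1) \<delta> K_shift] norm_radial[OF r(2) \<delta> F_shift]
      by (auto simp: S_def R_def)
  qed
  have R_cont: "continuous_on (K \<times> F) R"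
    unfolding R_def
    by (intro continuous_on_Pair continuous_on_compose2[OF continuous_on_radial[OF \<delta> K_shift]]
        continuous_on_compose2[OF continuous_on_radial[OF \<delta> F_shift]] continuous_intros) auto
  define Q where "Q = {x :: nat \<Rightarrow> real. \<forall>i. x i \<in> {0..1}}"
  define G where "G c = (\<Sum>i<n. c i *\<^sub>R w i)" for c :: "nat \<Rightarrow> real"
  have G_in: "G c \<in> K \<times> F" if "c \<in> Q" for c
  proof -
    have "fst (w i) \<in> K" if "i < n" for i
      using w[OF that] C(2) by (auto simp: mem_Times_iff)
    then have "fst (G c) \<in> K"
      using that unfolding G_def fst_sum fst_scaleR
      by (intro closed_pointed_cone_sum[OF K(1)]) (auto simp: Q_def)
    moreover have "snd (G c) \<in> F"
      unfolding G_def F_def snd_sum snd_scaleR by (intro span_sum span_scale span_base) auto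
    ultimately show ?thesis
      by (simp add: mem_Times_iff)
  qed
  have "continuous_on Q (\<lambda>c. c i)" for i
    by (rule continuous_on_subset[OF continuous_on_product_coordinates]) simp
  then have G_cont: "continuous_on Q G"
    unfolding G_def by (intro continuous_on_sum continuous_on_scaleR continuous_on_const)
  have TRG: "T (R (G c)) \<in> C" if "c \<in> Q" for c
    by (rule Pi_mem[OF T(2) R_in[OF G_in[OF that]]])
  \<comment> \<open>The cycle cube, \<open>K \<times> F\<close>, \<open>S\<close>, \<open>C\<close>
    is cut at the cube, so that the self-map acts on coefficients.\<close>
  define f where "f c i = \<phi> i (T (R (G c)))" for c i
  have RG_cont: "continuous_on Q (\<lambda>c. R (G c))"
    by (rule continuous_on_compose2[OF R_cont G_cont]) (intro image_subsetI G_in)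
  have TRG_cont: "continuous_on Q (\<lambda>c. T (R (G c)))"
    by (rule continuous_on_compose2[OF T(1) RG_cont]) (intro image_subsetI R_in G_in)
  have "continuous_on Q (\<lambda>c. f c i)" for i
    unfolding f_def by (rule continuous_on_compose2[OF \<phi>_cont TRG_cont]) (intro image_subsetI TRG)
  then have "continuous_on Q f"
    by (rule continuous_on_coordinatewise_then_product)
  moreover have "f \<in> Q \<rightarrow> Q"
    using \<phi>[OF TRG] by (auto simp: f_def Q_def)
  ultimately obtain c where c: "c \<in> Q" "f c = c"
    by (rule fixed_point_unit_cube[of f, folded Q_def])
  define z g where "z = R (G c)" and "g = G c"
  have z: "z \<in> S"
    unfolding z_def by (intro R_in G_in c)
  have g: "norm (g - T z) \<le> \<epsilon>"
  proof -
    \<comment> \<open>Since \<open>f c = c\<close>, the coefficients of \<open>g\<close> are the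
      Schauder weights of \<open>T z\<close>.\<close>
    have "g = (\<Sum>i<n. \<phi> i (T z) *\<^sub>R w i)"
      using fun_cong[OF c(2)] by (simp add: g_def G_def z_def f_def)
    moreover have "T z \<in> C"
      by (rule Pi_mem[OF T(2) z])
    ultimately show ?thesis
      using approx by simp
  qed
  \<comment> \<open>The Euclidean product norm dominates the norm of each component.\<close>
  have "norm (fst h) \<le> norm h" "norm (snd h) \<le> norm h" for h :: "'a \<times> 'b"
    using norm_fst_le[of "fst h" "snd h"] norm_snd_le[of "snd h" "fst h"] by simp_all
  from order_trans[OF this(1) g] order_trans[OF this(2) g]
  have "norm (fst g - fst (T z)) \<le> \<epsilon>" "norm (snd g - snd (T z)) \<le> \<epsilon>"
    by simp_all
  then have "\<delta> \<le> norm (fst g)" "\<delta> \<le> norm (snd g)"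
    using d[OF z] norm_triangle_ineq2[of "fst (T z)" "fst g"]
      norm_triangle_ineq2[of "snd (T z)" "snd g"]
    by (simp_all add: \<delta>_def norm_minus_commute)
  then have "z = ((r1 / norm (fst g)) *\<^sub>R fst g, (r2 / norm (snd g)) *\<^sub>R snd g)"
    by (simp add: z_def R_def g_def radial_eq)
  with z g show ?thesis
    by (rule that)
qed

text \<open>Along a subsequence the values \<open>T (z n)\<close> converge in \<open>C\<close> to
  some \<open>t\<close>. The approximants \<open>g n\<close> have the same limit, so the points
  \<open>z n\<close>, being normalizations of \<open>g n\<close>, converge to \<open>N t\<close>,
  and continuity of \<open>T\<close> closes the loop.\<close>

lemma normalized_fixed_point:
  fixes K :: "'a::real_normed_vector set"
    and T :: "'a \<times> 'b::real_normed_vector \<Rightarrow> 'a \<times> 'b"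
    and r1 r2 d :: real
  defines "S \<equiv> {(x, y). x \<in> K \<and> norm x = r1 \<and> norm y = r2}"
  assumes K: "closed_pointed_cone K" "K \<noteq> {0}"
    and inf_dim: "\<nexists>B. finite_dimensional_vector_space ((*\<^sub>R) :: real \<Rightarrow> 'b \<Rightarrow> 'b) B"
    and r: "0 < r1" "0 < r2"
    and C: "compact C" "C \<subseteq> K \<times> UNIV"
    and T: "continuous_on S T" "T \<in> S \<rightarrow> C"
    and d: "0 < d" "\<And>z. z \<in> S \<Longrightarrow> d \<le> norm (fst (T z))" "\<And>z. z \<in> S \<Longrightarrow> d \<le> norm (snd (T z))"
  obtains z where "z \<in> S"
    "z = ((r1 / norm (fst (T z))) *\<^sub>R fst (T z), (r2 / norm (snd (T z))) *\<^sub>R snd (T z))"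
proof -
  define N where "N t = ((r1 / norm (fst t)) *\<^sub>R fst t, (r2 / norm (snd t)) *\<^sub>R snd t)" for t :: "'a \<times> 'b"
  \<comment> \<open>The denominator \<open>n + 2\<close> keeps the error strictly below
    \<open>d\<close> already at \<open>n = 0\<close>.\<close>
  have "\<exists>z g. z \<in> S \<and> norm (g - T z) \<le> d / (real n + 2) \<and> z = N g" for n :: nat
  proof -
    have "0 < d / (real n + 2)" "d / (real n + 2) < d"
      using d(1) by (simp_all add: divide_simps)
    note eps = this
    obtain z g where "z \<in> S" "norm (g - T z) \<le> d / (real n + 2)" "z = N g"
      by (rule approximate_normalized_fixed_point[OF K inf_dim r C T[unfolded S_def]
            d(2,3)[unfolded S_def] eps, folded S_def N_def]) (assumption | rule that)+
    then show ?thesis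
      by blast
  qed
  then obtain z g where z: "\<And>n. z n \<in> S" and g: "\<And>n. norm (g n - T (z n)) \<le> d / (real n + 2)"
    and zN: "\<And>n. z n = N (g n)"
    by metis
  have "T (z n) \<in> C" for n
    by (rule Pi_mem[OF T(2) z])
  then obtain t \<sigma> where t: "t \<in> C" and \<sigma>: "strict_mono \<sigma>" and lim: "(\<lambda>n. T (z (\<sigma> n))) \<longlonglongrightarrow> t"
    using C(1) unfolding compact_def o_def by meson
  have "(\<lambda>n. d / (real n + 2)) \<longlonglongrightarrow> 0"
    by real_asymp
  then have "(\<lambda>n. g n - T (z n)) \<longlonglongrightarrow> 0"
    by (rule Lim_null_comparison[rotated]) (use g in auto)
  from tendsto_add[OF LIMSEQ_subseq_LIMSEQ[OF this \<sigma>] lim]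
  have g_lim: "(\<lambda>n. g (\<sigma> n)) \<longlonglongrightarrow> t"
    by (simp add: o_def)
  \<comment> \<open>The lower bound survives the limit, so \<open>N\<close> is continuous at
    \<open>t\<close>.\<close>
  have t_norm: "d \<le> norm (fst t)" "d \<le> norm (snd t)"
    using tendsto_lowerbound[OF tendsto_norm[OF tendsto_fst[OF lim]], of d]
      tendsto_lowerbound[OF tendsto_norm[OF tendsto_snd[OF lim]], of d] d(2,3) z by auto
  then have "(\<lambda>n. N (g (\<sigma> n))) \<longlonglongrightarrow> N t"
    unfolding N_def using d(1) by (intro tendsto_intros g_lim) auto
  then have z_lim: "(\<lambda>n. z (\<sigma> n)) \<longlonglongrightarrow> N t"
    by (simp add: zN)
  have "N t \<in> S"
    using t C(2) t_norm d(1) r K(1)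
    by (auto simp: S_def N_def closed_pointed_cone_def cone_def mem_Times_iff)
  moreover from this have "T (N t) = t"
    by (intro LIMSEQ_unique[OF continuous_on_tendsto_compose[OF T(1) z_lim] lim]) (simp_all add: z)
  ultimately show ?thesis
    using that[of "N t"] by (simp add: N_def)
qed

section \<open>The two solutions\<close>

theorem theorem2p5:
  fixes K1 :: "'a::real_normed_vector set"
    and T1 :: "'a \<times> 'b::real_normed_vector \<Rightarrow> 'a"
    and T2 :: "'a \<times> 'b \<Rightarrow> 'b"
    and r1 r2 :: real
  assumes "closed_pointed_cone K1" and "K1 \<noteq> {0}"
    and "\<nexists>B. finite_dimensional_vector_space ((*\<^sub>R) :: real \<Rightarrow> 'b \<Rightarrow> 'b) B"
    and "r1 > 0" and "r2 > 0"
    and "compact_map_on ((K1 \<inter> cball 0 r1) \<times> cball 0 r2) (K1 \<times> UNIV) (\<lambda>z. (T1 z, T2 z))"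
    and "Inf {norm (T1 (x, y)) | x y. x \<in> K1 \<and> norm x = r1 \<and> norm y = r2} > 0"
    and "Inf {norm (T2 (x, y)) | x y. x \<in> K1 \<and> norm x = r1 \<and> norm y = r2} > 0"
  shows "\<exists>l11 l21 l12 l22. \<exists>x01 y01 x02 y02.
      l11 > 0 \<and> l21 > 0 \<and> l12 > 0 \<and> l22 < 0 \<and>
      (x01, y01) \<in> (K1 \<inter> cball 0 r1) \<times> cball 0 r2 \<and> norm x01 = r1 \<and> norm y01 = r2 \<and>
      (x02, y02) \<in> (K1 \<inter> cball 0 r1) \<times> cball 0 r2 \<and> norm x02 = r1 \<and> norm y02 = r2 \<and>
      x01 = l11 *\<^sub>R T1 (x01, y01) \<and> y01 = l21 *\<^sub>R T2 (x01, y01) \<and>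
      x02 = l12 *\<^sub>R T1 (x02, y02) \<and> y02 = l22 *\<^sub>R T2 (x02, y02)"
proof -
  define D where "D = (K1 \<inter> cball 0 r1) \<times> cball (0::'b) r2"
  define S where "S = {(x, y :: 'b). x \<in> K1 \<and> norm x = r1 \<and> norm y = r2}"
  \<comment> \<open>This relative closure is the set that \<open>compact_map_on\<close> makes
    compact; it lies in \<open>K1 \<times> UNIV\<close> by construction.\<close>
  define C where "C = (K1 \<times> UNIV) \<inter> closure ((\<lambda>z. (T1 z, T2 z)) ` D)"
  define d1 d2 where "d1 = Inf {norm (T1 (x, y)) | x y. x \<in> K1 \<and> norm x = r1 \<and> norm y = r2}"
    and "d2 = Inf {norm (T2 (x, y)) | x y. x \<in> K1 \<and> norm x = r1 \<and> norm y = r2}"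
  have d: "0 < min d1 d2"
    using assms(7,8) by (simp add: d1_def d2_def)
  have dT: "min d1 d2 \<le> norm (T1 z)" "min d1 d2 \<le> norm (T2 z)" if "z \<in> S" for z
  proof -
    have "d1 \<le> norm (T1 z)"
      unfolding d1_def using that by (intro cInf_lower bdd_belowI[of _ 0]) (auto simp: S_def)
    moreover have "d2 \<le> norm (T2 z)"
      unfolding d2_def using that by (intro cInf_lower bdd_belowI[of _ 0]) (auto simp: S_def)
    ultimately show "min d1 d2 \<le> norm (T1 z)" "min d1 d2 \<le> norm (T2 z)"
      by auto
  qed
  have SD: "S \<subseteq> D"
    by (auto simp: S_def D_def)
  have T: "continuous_on D (\<lambda>z. (T1 z, T2 z))" "(\<lambda>z. (T1 z, T2 z)) ` D \<subseteq> C" "compact C"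
    using assms(6) closure_subset[of "(\<lambda>z. (T1 z, T2 z)) ` D"]
    unfolding compact_map_on_def C_def D_def by simp_all
  \<comment> \<open>Both signs are treated at once: \<open>s\<close> disappears from the norm of
    \<open>s *\<^sub>R T2 z\<close> and survives as the sign of the second multiplier.\<close>
  have *: "\<exists>x y a b. (x, y) \<in> S \<and> 0 < a \<and> 0 < b \<and> x = a *\<^sub>R T1 (x, y) \<and> y = (b * s) *\<^sub>R T2 (x, y)"
    if s: "\<bar>s\<bar> = 1" for s :: real
  proof -
    define C' where "C' = (\<lambda>t. (fst t, s *\<^sub>R snd t)) ` C"
    have C': "compact C'" "C' \<subseteq> K1 \<times> UNIV"
      unfolding C'_def using T(3)
      by (auto simp: C_def intro!: compact_continuous_image continuous_intros)
    have cont: "continuous_on S (\<lambda>z. (T1 z, s *\<^sub>R T2 z))"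
      using continuous_on_fst[OF T(1)] continuous_on_snd[OF T(1)] SD
      by (auto intro!: continuous_intros intro: continuous_on_subset)
    have maps: "(\<lambda>z. (T1 z, s *\<^sub>R T2 z)) \<in> S \<rightarrow> C'"
      using T(2) SD by (force simp: C'_def)
    obtain z where z: "z \<in> S"
      "z = ((r1 / norm (T1 z)) *\<^sub>R T1 z, (r2 / norm (s *\<^sub>R T2 z)) *\<^sub>R s *\<^sub>R T2 z)"
      using normalized_fixed_point[OF assms(1-5) C' cont[unfolded S_def] maps[unfolded S_def] d,
          folded S_def] dT s by auto
    have "0 < norm (T1 z)" "0 < norm (T2 z)"
      using d dT[OF z(1)] by linarith+
    moreover obtain x y where xy: "z = (x, y)"
      by (cases z)
    ultimately have "0 < r1 / norm (T1 (x, y))" "0 < r2 / norm (T2 (x, y))"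
      using assms(4,5) by simp_all
    moreover have "x = (r1 / norm (T1 (x, y))) *\<^sub>R T1 (x, y)"
      "y = (r2 / norm (T2 (x, y)) * s) *\<^sub>R T2 (x, y)"
      using z(2) s unfolding xy by simp_all
    ultimately show ?thesis
      using z(1) unfolding xy by blast
  qed
  obtain x1 y1 a1 b1 where 1: "(x1, y1) \<in> S" "0 < a1" "0 < b1"
    "x1 = a1 *\<^sub>R T1 (x1, y1)" "y1 = b1 *\<^sub>R T2 (x1, y1)"
    using *[of 1] by auto
  obtain x2 y2 a2 b2 where 2: "(x2, y2) \<in> S" "0 < a2" "0 < b2"
    "x2 = a2 *\<^sub>R T1 (x2, y2)" "y2 = (- b2) *\<^sub>R T2 (x2, y2)"
    using *[of "-1"] by auto
  have "(x1, y1) \<in> D" "(x2, y2) \<in> D" "norm x1 = r1" "norm y1 = r2" "norm x2 = r1" "norm y2 = r2"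
    using 1(1) 2(1) SD by (auto simp: S_def)
  with 1 2 show ?thesis
    unfolding D_def
    by (intro exI[of _ a1] exI[of _ b1] exI[of _ a2] exI[of _ "- b2"] exI[of _ x1] exI[of _ y1]
        exI[of _ x2] exI[of _ y2]) auto
qed

end
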